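(* Let $f_i\in\mathcal{C}^1(\mathbb{R}^n)$, $1\le i\le m$, be anisotropically smooth relative to $\phi$ with constants $L_i>0$, and assume that the Bregman distance $D_{\phi^*}$ is jointly convex. Let $\alpha_i\ge0$ with $\sum_{i=1}^m\alpha_i=1$. Then $\sum_{i=1}^m\alpha_if_i$ is anisotropically smooth relative to $\phi$ with constant $L:=\max_{1\le i\le m}L_i$.
   Context: Standing assumption: $\phi:\mathbb{R}^n\to\mathbb{R}$ is convex with full domain and Legendre (essentially smooth and essentially strictly convex in the sense of Rockafellar). Consequently $\nabla\phi:\mathbb{R}^n\to\operatorname{int}\operatorname{dom}\phi^*$ is a bijection with inverse $\nabla\phi^*$, where $\phi^*$ is the convex conjugate. For $\lambda>0$, $(\lambda\star\phi)(x)=\lambda\phi(\lambda^{-1}x)$. $f\in\mathcal{C}^1(\mathbb{R}^n)$ is anisotropically smooth relative to $\phi$ with constant $L>0$ if $\operatorname{rge}\nabla f\subseteq\operatorname{rge}\nabla\phi$ (rge = range) and for all $\bar x,x\in\mathbb{R}^n$ $$f(x)\le f(\bar x)+\tfrac1L\star\phi\big(x-\bar x+L^{-1}\nabla\phi^*(\nabla f(\bar x))\big)-\tfrac1L\star\phi\big(L^{-1}\nabla\phi^*(\nabla f(\bar x))\big).$$ The Bregman distance generated by $\phi^*$ is $D_{\phi^*}(x,y)=\phi^*(x)-\phi^*(y)-\langle\nabla\phi^*(y),x-y\rangle$ if $x\in\operatorname{dom}\phi^*$, $y\in\operatorname{int}\operatorname{dom}\phi^*$, and $+\infty$ otherwise;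 jointly convex means convex as a function of $(x,y)\in\mathbb{R}^n\times\mathbb{R}^n$. *)

theory Defs
  imports "HOL-Analysis.Analysis"
begin

definition gradient :: "('a::euclidean_space \<Rightarrow> real) \<Rightarrow> 'a \<Rightarrow> 'a" where
  "gradient f x = (THE D. GDERIV f x :> D)"

definition C1_fun :: "('a::euclidean_space \<Rightarrow> real) \<Rightarrow> bool" where
  "C1_fun f \<longleftrightarrow> (\<forall>x. f differentiable (at x)) \<and> continuous_on UNIV (gradient f)"

definition effective_domain :: "('a \<Rightarrow> ereal) \<Rightarrow> 'a set" where
  "effective_domain h = {x. h x < \<infinity>}"

text \<open>Only meaningful at points near which \<open>h\<close> is finite; there \<^const>\<open>real_of_ereal\<close>
  does not change the function.\<close>

definition egradient :: "('a::euclidean_space \<Rightarrow> ereal) \<Rightarrow> 'a \<Rightarrow> 'a" where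
  "egradient h = gradient (\<lambda>x. real_of_ereal (h x))"

text \<open>Convexity via the epigraph, which avoids expressions such as \<open>\<infinity> - \<infinity>\<close>.\<close>

definition econvex :: "('a::real_vector \<Rightarrow> ereal) \<Rightarrow> bool" where
  "econvex h \<longleftrightarrow> convex {(x, r::real). h x \<le> ereal r}"

definition convex_conjugate :: "('a::euclidean_space \<Rightarrow> ereal) \<Rightarrow> 'a \<Rightarrow> ereal" where
  "convex_conjugate h y = (SUP x. ereal (y \<bullet> x) - h x)"

text \<open>For proper \<open>h\<close> this is empty wherever \<open>h x = \<infinity>\<close>.\<close>

definition subdifferential :: "('a::euclidean_space \<Rightarrow> ereal) \<Rightarrow> 'a \<Rightarrow> 'a set" where
  "subdifferential h x = {v. \<forall>z. h z \<ge> h x + ereal (v \<bullet> (z - x))}"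

text \<open>Rockafellar's notions, for a proper convex function \<open>h\<close>.\<close>

definition essentially_smooth :: "('a::euclidean_space \<Rightarrow> ereal) \<Rightarrow> bool" where
  "essentially_smooth h \<longleftrightarrow>
     (let C = interior (effective_domain h) in
       C \<noteq> {} \<and>
       (\<forall>x\<in>C. (\<lambda>z. real_of_ereal (h z)) differentiable (at x)) \<and>
       (\<forall>X x. (\<forall>k. X k \<in> C) \<and> X \<longlonglongrightarrow> x \<and> x \<in> frontier C \<longrightarrow>
          filterlim (\<lambda>k. norm (egradient h (X k))) at_top sequentially))"

definition strictly_econvex_on :: "'a::euclidean_space set \<Rightarrow> ('a \<Rightarrow> ereal) \<Rightarrow> bool" where
  "strictly_econvex_on S h \<longleftrightarrow>
     (\<forall>x\<in>S. \<forall>y\<in>S. \<forall>t. x \<noteq> y \<and> 0 < t \<and> t < 1 \<longrightarrow>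
        h ((1 - t) *\<^sub>R x + t *\<^sub>R y) < ereal (1 - t) * h x + ereal t * h y)"

definition essentially_strictly_convex :: "('a::euclidean_space \<Rightarrow> ereal) \<Rightarrow> bool" where
  "essentially_strictly_convex h \<longleftrightarrow>
     (\<forall>S. convex S \<and> S \<subseteq> {x. subdifferential h x \<noteq> {}} \<longrightarrow> strictly_econvex_on S h)"

definition legendre :: "('a::euclidean_space \<Rightarrow> ereal) \<Rightarrow> bool" where
  "legendre h \<longleftrightarrow> essentially_smooth h \<and> essentially_strictly_convex h"

definition bregman :: "('a::euclidean_space \<Rightarrow> ereal) \<Rightarrow> 'a \<Rightarrow> 'a \<Rightarrow> ereal" where
  "bregman h x y =
     (if x \<in> effective_domain h \<and> y \<in> interior (effective_domain h)
      then h x - h y - ereal (egradient h y \<bullet> (x - y))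
      else \<infinity>)"

text \<open>A reference function \<open>\<phi>\<close> with full domain is represented as a real-valued function;
  its conjugate may still take the value \<open>\<infinity>\<close>.\<close>

definition conj_real :: "('a::euclidean_space \<Rightarrow> real) \<Rightarrow> 'a \<Rightarrow> ereal" where
  "conj_real \<phi> = convex_conjugate (\<lambda>x. ereal (\<phi> x))"

definition epi_scaling :: "real \<Rightarrow> ('a::euclidean_space \<Rightarrow> real) \<Rightarrow> 'a \<Rightarrow> real" where
  "epi_scaling c \<phi> x = c * \<phi> (inverse c *\<^sub>R x)"

definition anisotropically_smooth ::
  "('a::euclidean_space \<Rightarrow> real) \<Rightarrow> real \<Rightarrow> ('a \<Rightarrow> real) \<Rightarrow> bool" where
  "anisotropically_smooth \<phi> L f \<longleftrightarrow>
     C1_fun f \<and> L > 0 \<and> range (gradient f) \<subseteq> range (gradient \<phi>) \<and>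
     (\<forall>xbar x.
        f x \<le> f xbar
          + epi_scaling (1 / L) \<phi>
              (x - xbar + inverse L *\<^sub>R egradient (conj_real \<phi>) (gradient f xbar))
          - epi_scaling (1 / L) \<phi>
              (inverse L *\<^sub>R egradient (conj_real \<phi>) (gradient f xbar)))"

end

theory Submission
  imports Defs
begin

text \<open>
  Fix a point \<open>xbar\<close>, let \<open>y = \<nabla>f(xbar)\<close> and \<open>u = \<nabla>\<phi>*(y)\<close>, so that \<open>\<nabla>\<phi>(u) = y\<close>. Unfolding the
  epi-scaling, anisotropic smoothness with constant \<open>L\<close> reads
  \<open>f(x) \<le> f(xbar) + (\<phi>(u + L(x - xbar)) - \<phi>(u)) / L\<close>
  (lemma \<open>anisotropically_smooth_iff\<close>). Two observations then suffice.

  First, the bound grows with \<open>L\<close>, because its last term is a difference quotient of the convex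
  function \<open>\<phi>\<close> (\<open>scaled_increment_mono\<close>). Hence all \<open>f\<^sub>i\<close> share the constant \<open>max L\<^sub>i\<close>.

  Second, for fixed \<open>d\<close> the increment \<open>\<phi>(u + d) - \<phi>(u)\<close> is a concave function of the dual
  variable \<open>y = \<nabla>\<phi>(u)\<close>. Writing \<open>\<phi>\<close> as the conjugate of \<open>\<phi>*\<close> and using the equality case of the
  Fenchel-Young inequality at \<open>u\<close> gives
  \<open>\<phi>(u + d) - \<phi>(u) = sup\<^sub>z (\<langle>z, d\<rangle> - D(z, y))\<close> for the Bregman distance \<open>D\<close> of \<open>\<phi>*\<close>,
  with the supremum attained at \<open>z = \<nabla>\<phi>(u + d)\<close>; a partial supremum of a jointly concave function
  is concave. Since the gradient of \<open>\<Sum> \<alpha>\<^sub>i f\<^sub>i\<close> is the convex combination of the gradients, adding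
  the descent inequalities of the \<open>f\<^sub>i\<close> and using this concavity
  (\<open>convex_combination_of_increments_le\<close>) gives the result.

  Passing between \<open>u\<close> and \<open>y\<close> needs Legendre duality: \<open>\<nabla>\<phi>\<close> maps onto the interior of the
  domain of \<open>\<phi>*\<close>, and \<open>\<nabla>\<phi>*\<close> inverts it. The first
  holds because \<open>\<phi> - \<langle>y, \<cdot>\<rangle>\<close> attains its minimum when \<open>y\<close> is interior, the second because strict
  convexity makes the tangent at \<open>u\<close> separate from the graph away from \<open>u\<close>.
\<close>

section \<open>Gradients\<close>

lemma gradient_eqI:
  assumes "GDERIV f x :> D"
  shows "gradient f x = D"
  unfolding gradient_def
proof (rule the_equality)
  show "GDERIV f x :> D" by fact
  fix E assume "GDERIV f x :> E"
  then have "(\<lambda>h. h \<bullet> E) = (\<lambda>h. h \<bullet> D)"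
    using assms has_derivative_unique unfolding gderiv_def by blast
  then have "\<forall>h. h \<bullet> E = h \<bullet> D"
    by (simp add: fun_eq_iff)
  then show "E = D"
    by (simp only: vector_eq_ldot)
qed

lemma GDERIV_gradient:
  fixes f :: "'a::euclidean_space \<Rightarrow> real"
  assumes "f differentiable (at x)"
  shows "GDERIV f x :> gradient f x"
proof -
  obtain f' where f': "(f has_derivative f') (at x)"
    using assms differentiable_def by blast
  then have lin: "linear f'"
    using has_derivative_linear by blast
  have "f' h = h \<bullet> adjoint f' 1" for h
    using adjoint_works[OF lin, of h 1] by simp
  then have "f' = (\<lambda>h. h \<bullet> adjoint f' 1)"
    by blast
  then have "GDERIV f x :> adjoint f' 1"
    using f' unfolding gderiv_def by metis
  then show ?thesis
    using gradient_eqI by metis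
qed

lemma GDERIV_weighted_sum:
  fixes f :: "'i \<Rightarrow> 'a::euclidean_space \<Rightarrow> real"
  assumes "\<And>i. i \<in> I \<Longrightarrow> f i differentiable (at x)"
  shows "GDERIV (\<lambda>x. \<Sum>i\<in>I. a i * f i x) x :> (\<Sum>i\<in>I. a i *\<^sub>R gradient (f i) x)"
proof -
  have "((\<lambda>x. \<Sum>i\<in>I. a i * f i x) has_derivative (\<lambda>h. \<Sum>i\<in>I. a i * (h \<bullet> gradient (f i) x))) (at x)"
    using GDERIV_gradient[OF assms] unfolding gderiv_def
    by (intro has_derivative_sum has_derivative_mult_right)
  then show ?thesis
    by (simp add: gderiv_def inner_sum_right)
qed

text \<open>Restricted to the segment from \<open>x\<close> to \<open>z\<close>, this is the statement that a convex function of one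
  real variable lies above its tangent.\<close>

lemma convex_gradient_inequality:
  fixes f :: "'a::euclidean_space \<Rightarrow> real"
  assumes "convex_on UNIV f" and "f differentiable (at x)"
  shows "f x + gradient f x \<bullet> (z - x) \<le> f z"
proof -
  define h where "h t = f (x + t *\<^sub>R (z - x))" for t
  have eq: "x + ((1 - t) * a + t * b) *\<^sub>R (z - x)
      = (1 - t) *\<^sub>R (x + a *\<^sub>R (z - x)) + t *\<^sub>R (x + b *\<^sub>R (z - x))" for t a b :: real
    by (simp add: algebra_simps)
  have "convex_on UNIV h"
    using convex_onD[OF assms(1)] by (intro convex_onI) (auto simp: h_def eq)
  moreover have "(h has_real_derivative gradient f x \<bullet> (z - x)) (at 0)"
  proof -
    have "(f has_derivative (\<lambda>h. h \<bullet> gradient f x)) (at (x + 0 *\<^sub>R (z - x)))"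
      using GDERIV_gradient[OF assms(2)] by (simp add: gderiv_def)
    then have "((\<lambda>t. f (x + t *\<^sub>R (z - x))) has_derivative
        (\<lambda>t. (t *\<^sub>R (z - x)) \<bullet> gradient f x)) (at 0)"
      by (rule has_derivative_compose[rotated]) (auto intro!: derivative_eq_intros)
    moreover have "(\<lambda>t. (t *\<^sub>R (z - x)) \<bullet> gradient f x) = (*) (gradient f x \<bullet> (z - x))"
      by (rule ext) (simp add: inner_commute[of "gradient f x"])
    ultimately show ?thesis
      unfolding has_field_derivative_def h_def by simp
  qed
  ultimately have "h 1 - h 0 \<ge> (gradient f x \<bullet> (z - x)) * (1 - 0)"
    by (intro convex_on_imp_above_tangent[where A = UNIV]) auto
  then show ?thesis
    by (simp add: h_def)
qed

section \<open>The conjugate of a Legendre function with full domain\<close>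

lemma Fenchel_Young: "ereal (y \<bullet> x - \<phi> x) \<le> conj_real \<phi> y"
  unfolding conj_real_def convex_conjugate_def by (auto intro: SUP_upper2[of x])

lemma conj_real_le_iff: "conj_real \<phi> y \<le> ereal c \<longleftrightarrow> (\<forall>x. y \<bullet> x - \<phi> x \<le> c)"
  unfolding conj_real_def convex_conjugate_def by (auto simp: SUP_le_iff)

locale legendre_function =
  fixes \<phi> :: "'a::euclidean_space \<Rightarrow> real"
  assumes convex: "convex_on UNIV \<phi>"
    and legendre: "legendre (\<lambda>x. ereal (\<phi> x))"
begin

abbreviation conjugate :: "'a \<Rightarrow> ereal" where
  "conjugate \<equiv> conj_real \<phi>"

lemma differentiable: "\<phi> differentiable (at x)"
  using legendre by (auto simp: legendre_def essentially_smooth_def effective_domain_def Let_def)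

lemma continuous: "continuous_on A \<phi>"
  using differentiable differentiable_imp_continuous_within
  by (meson continuous_at_imp_continuous_on)

lemma tangent_le: "\<phi> x + gradient \<phi> x \<bullet> (z - x) \<le> \<phi> z"
  using convex_gradient_inequality convex differentiable by blast

text \<open>Differentiability makes every subdifferential nonempty, so essential strict convexity is strict
  convexity on the whole space. A tangent hyperplane that met the graph at a second point \<open>z\<close> would
  therefore lie strictly above it at the midpoint of \<open>x\<close> and \<open>z\<close>.\<close>

lemma tangent_less:
  assumes "z \<noteq> x"
  shows "\<phi> x + gradient \<phi> x \<bullet> (z - x) < \<phi> z"
proof (rule ccontr)
  assume "\<not> ?thesis"
  then have touch: "\<phi> z \<le> \<phi> x + gradient \<phi> x \<bullet> (z - x)"
    by simp
  have "subdifferential (\<lambda>x. ereal (\<phi> x)) u \<noteq> {}" for u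
    using tangent_le[of u] by (auto simp: subdifferential_def)
  then have "strictly_econvex_on UNIV (\<lambda>x. ereal (\<phi> x))"
    using legendre by (auto simp: legendre_def essentially_strictly_convex_def)
  then have "ereal (\<phi> ((1 - 1/2) *\<^sub>R x + (1/2) *\<^sub>R z)) < ereal (1 - 1/2) * ereal (\<phi> x) + ereal (1/2) * ereal (\<phi> z)"
    unfolding strictly_econvex_on_def using assms
    by (elim ballE[of _ _ x] ballE[of _ _ z] allE[of _ "1/2"]) auto
  then have "\<phi> ((1/2) *\<^sub>R x + (1/2) *\<^sub>R z) < (\<phi> x + \<phi> z) / 2"
    by simp
  moreover have "(1/2) *\<^sub>R x + (1/2) *\<^sub>R z - x = (1/2) *\<^sub>R (z - x)"
    by (simp add: scaleR_diff_right) (simp flip: scaleR_add_left add: algebra_simps)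
  ultimately show False
    using touch tangent_le[of x "(1/2) *\<^sub>R x + (1/2) *\<^sub>R z"] by simp
qed

lemma conj_gradient: "conjugate (gradient \<phi> x) = ereal (gradient \<phi> x \<bullet> x - \<phi> x)"
proof (rule antisym)
  show "conjugate (gradient \<phi> x) \<le> ereal (gradient \<phi> x \<bullet> x - \<phi> x)"
    unfolding conj_real_le_iff using tangent_le[of x] by (auto simp: inner_diff_right algebra_simps)
qed (rule Fenchel_Young)

text \<open>This one-sided estimate carries the local theory of the conjugate: with any fixed \<open>\<epsilon>\<close> it shows
  that the conjugate is finite near \<open>\<nabla>\<phi>(x)\<close>, and with \<open>\<epsilon>\<close> tending to \<open>0\<close>, together with
  the Fenchel-Young inequality as lower bound, it shows that its gradient there is \<open>x\<close>.

  The gap between \<open>\<phi>\<close> and its tangent at \<open>x\<close> has a positive minimum \<open>\<delta>\<close> on the sphere of radius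
  \<open>\<epsilon>\<close> around \<open>x\<close>, and by convexity it grows at least linearly, with slope \<open>\<delta> / \<epsilon>\<close>, outside. A
  perturbation of the slope by at most \<open>\<delta> / \<epsilon>\<close> is absorbed by the gap outside the sphere; inside it
  contributes at most \<open>\<epsilon>\<close> times its norm.\<close>

lemma conj_le_near_gradient:
  assumes "\<epsilon> > 0"
  shows "\<exists>\<eta>>0. \<forall>y. norm (y - gradient \<phi> x) \<le> \<eta> \<longrightarrow>
    conjugate y \<le> ereal (y \<bullet> x - \<phi> x + \<epsilon> * norm (y - gradient \<phi> x))"
proof -
  define gap where "gap s = \<phi> (x + s) - \<phi> x - gradient \<phi> x \<bullet> s" for s
  have gap_nonneg: "gap s \<ge> 0" for s
    using tangent_le[of x "x + s"] by (simp add: gap_def)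
  obtain \<delta> where \<delta>: "\<delta> > 0" "\<And>s. norm s = \<epsilon> \<Longrightarrow> \<delta> \<le> gap s"
  proof -
    obtain b :: 'a where "b \<in> Basis"
      using nonempty_Basis by blast
    then have "\<epsilon> *\<^sub>R b \<in> sphere 0 \<epsilon>"
      using assms by simp
    then have ne: "sphere (0::'a) \<epsilon> \<noteq> {}"
      by blast
    have "continuous_on (sphere 0 \<epsilon>) gap"
      unfolding gap_def
      by (intro continuous_intros continuous_on_compose2[OF continuous[of UNIV]]) auto
    then obtain s0 where s0: "s0 \<in> sphere 0 \<epsilon>" "\<And>s. s \<in> sphere 0 \<epsilon> \<Longrightarrow> gap s0 \<le> gap s"
      using continuous_attains_inf[OF compact_sphere ne] by metis
    have "x + s0 \<noteq> x"
      using s0(1) assms by auto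
    then have "gap s0 > 0"
      using tangent_less[of "x + s0" x] by (simp add: gap_def)
    then show thesis
      using that s0(2) by simp
  qed
  have gap_far: "\<delta> / \<epsilon> * norm s \<le> gap s" if "norm s \<ge> \<epsilon>" for s
  proof -
    \<comment> \<open>\<open>t *\<^sub>R s\<close> is the point where the segment from \<open>0\<close> to \<open>s\<close> crosses the sphere.\<close>
    define t where "t = \<epsilon> / norm s"
    have ns: "norm s > 0"
      using that assms by linarith
    have t: "0 < t" "t \<le> 1"
      using that assms ns by (auto simp: t_def)
    have "norm (t *\<^sub>R s) = \<epsilon>"
      using ns assms by (simp add: t_def)
    then have "\<delta> \<le> gap (t *\<^sub>R s)"
      by (rule \<delta>)
    also have "\<dots> \<le> t * gap s"
    proof -
      have "(1 - t) *\<^sub>R x + t *\<^sub>R (x + s) = x + t *\<^sub>R s"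
        by (simp add: algebra_simps)
      then show ?thesis
        using convex_onD[OF convex, of t x "x + s"] t by (simp add: gap_def algebra_simps)
    qed
    finally show ?thesis
      using ns assms by (simp add: t_def field_simps)
  qed
  have "conjugate y \<le> ereal (y \<bullet> x - \<phi> x + \<epsilon> * norm (y - gradient \<phi> x))"
    if y: "norm (y - gradient \<phi> x) \<le> \<delta> / \<epsilon>" for y
    unfolding conj_real_le_iff
  proof
    fix w
    define s where "s = w - x"
    have w: "w = x + s"
      by (simp add: s_def)
    have inner_le: "(y - gradient \<phi> x) \<bullet> s \<le> norm (y - gradient \<phi> x) * norm s"
      by (rule norm_cauchy_schwarz)
    have "(y - gradient \<phi> x) \<bullet> s - gap s \<le> \<epsilon> * norm (y - gradient \<phi> x)"
    proof (cases "norm s \<ge> \<epsilon>")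
      case True
      have "norm (y - gradient \<phi> x) * norm s \<le> \<delta> / \<epsilon> * norm s"
        using y by (intro mult_right_mono) auto
      then show ?thesis
        using inner_le gap_far[OF True] assms
        by (smt (verit) mult_nonneg_nonneg norm_ge_zero)
    next
      case False
      then have "norm (y - gradient \<phi> x) * norm s \<le> norm (y - gradient \<phi> x) * \<epsilon>"
        by (intro mult_left_mono) auto
      then show ?thesis
        using inner_le gap_nonneg[of s] by (simp add: mult.commute)
    qed
    then show "y \<bullet> w - \<phi> w \<le> y \<bullet> x - \<phi> x + \<epsilon> * norm (y - gradient \<phi> x)"
      by (simp add: w gap_def inner_diff_left inner_add_right)
  qed
  then show ?thesis
    using \<delta>(1) assms by (intro exI[of _ "\<delta> / \<epsilon>"]) auto
qed

lemma gradient_in_interior_domain: "gradient \<phi> x \<in> interior (effective_domain conjugate)"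
proof -
  obtain \<eta> where \<eta>: "\<eta> > 0"
    and le: "\<And>y. norm (y - gradient \<phi> x) \<le> \<eta> \<Longrightarrow>
      conjugate y \<le> ereal (y \<bullet> x - \<phi> x + 1 * norm (y - gradient \<phi> x))"
    using conj_le_near_gradient[of 1 x] by auto
  have "conjugate y < \<infinity>" if "y \<in> ball (gradient \<phi> x) \<eta>" for y
    using le[of y] that by (auto simp: dist_norm norm_minus_commute intro: le_less_trans)
  then have "ball (gradient \<phi> x) \<eta> \<subseteq> effective_domain conjugate"
    by (auto simp: effective_domain_def)
  then show ?thesis
    using \<eta> by (auto simp: mem_interior)
qed

lemma egradient_conj_gradient: "egradient conjugate (gradient \<phi> x) = x"
  unfolding egradient_def
proof (rule gradient_eqI)
  let ?y = "gradient \<phi> x" and ?c = "\<lambda>y. real_of_ereal (conjugate y)"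
  have "\<exists>d>0. \<forall>y. norm (y - ?y) < d \<longrightarrow> norm (?c y - ?c ?y - (y - ?y) \<bullet> x) \<le> e * norm (y - ?y)"
    if "e > 0" for e
  proof -
    obtain d where d: "d > 0"
      and le: "\<And>y. norm (y - ?y) \<le> d \<Longrightarrow> conjugate y \<le> ereal (y \<bullet> x - \<phi> x + e * norm (y - ?y))"
      using conj_le_near_gradient[OF \<open>e > 0\<close>, of x] by (elim exE conjE) (rule that, auto)
    have "norm (?c y - ?c ?y - (y - ?y) \<bullet> x) \<le> e * norm (y - ?y)" if y: "norm (y - ?y) < d" for y
    proof -
      have "conjugate y \<le> ereal (y \<bullet> x - \<phi> x + e * norm (y - ?y))"
        using le y by simp
      moreover have "ereal (y \<bullet> x - \<phi> x) \<le> conjugate y"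
        by (rule Fenchel_Young)
      ultimately have "y \<bullet> x - \<phi> x \<le> ?c y" "?c y \<le> y \<bullet> x - \<phi> x + e * norm (y - ?y)"
        by (cases "conjugate y"; simp)+
      then show ?thesis
        by (simp add: conj_gradient inner_diff_left)
    qed
    then show ?thesis
      using d by blast
  qed
  then show "GDERIV ?c ?y :> x"
    unfolding gderiv_def has_derivative_at_alt
    by (auto intro: bounded_linear_inner_left)
qed

text \<open>If the conjugate is finite around \<open>y\<close>, then \<open>\<phi>(x) - \<langle>y, x\<rangle>\<close> is coercive and so has a
  minimiser, at which the gradient of \<open>\<phi>\<close> equals \<open>y\<close>. For coercivity it is enough that the conjugate
  is finite at the finitely many points \<open>y + r b\<close> and \<open>y - r b\<close> with \<open>b\<close> in the basis: this bounds each
  coordinate of \<open>x\<close>, and the coordinates bound the norm.\<close>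

lemma interior_domain_subset_range_gradient:
  "interior (effective_domain conjugate) \<subseteq> range (gradient \<phi>)"
proof
  fix y assume "y \<in> interior (effective_domain conjugate)"
  then obtain r where r: "r > 0" and dom: "cball y r \<subseteq> effective_domain conjugate"
    unfolding mem_interior_cball by blast
  define V :: "'a set" where "V = Basis \<union> uminus ` Basis"
  have "\<exists>c. \<forall>x. (y + r *\<^sub>R v) \<bullet> x - \<phi> x \<le> c" if "v \<in> V" for v
  proof -
    have "y + r *\<^sub>R v \<in> cball y r"
      using that r by (auto simp: V_def dist_norm)
    then have "conjugate (y + r *\<^sub>R v) < \<infinity>"
      using dom by (auto simp: effective_domain_def)
    then obtain c where "conjugate (y + r *\<^sub>R v) \<le> ereal c"
      by (cases "conjugate (y + r *\<^sub>R v)") auto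
    then show ?thesis
      unfolding conj_real_le_iff by blast
  qed
  then obtain c where c: "\<And>v x. v \<in> V \<Longrightarrow> (y + r *\<^sub>R v) \<bullet> x - \<phi> x \<le> c v"
    by metis
  define M where "M = (\<Sum>v\<in>V. \<bar>c v\<bar>)"
  have "finite V"
    by (simp add: V_def)
  then have cM: "c v \<le> M" if "v \<in> V" for v
    using that member_le_sum[of v V "\<lambda>v. \<bar>c v\<bar>"] by (auto simp: M_def)
  define \<psi> where "\<psi> x = \<phi> x - y \<bullet> x" for x
  have comp: "r * \<bar>b \<bullet> x\<bar> \<le> \<psi> x + M" if "b \<in> Basis" for b x
  proof -
    have V: "b \<in> V" "- b \<in> V"
      using that by (auto simp: V_def)
    have "r * (b \<bullet> x) \<le> \<psi> x + M" "- (r * (b \<bullet> x)) \<le> \<psi> x + M"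
      using c[OF V(1), of x] c[OF V(2), of x] cM[OF V(1)] cM[OF V(2)]
      by (auto simp: \<psi>_def inner_add_left inner_diff_left)
    then show ?thesis
      by (cases "b \<bullet> x \<ge> 0") auto
  qed
  have coercive: "r * norm x \<le> DIM('a) * (\<psi> x + M)" for x
  proof -
    have "r * norm x \<le> r * (\<Sum>b\<in>Basis. \<bar>x \<bullet> b\<bar>)"
      using r norm_le_l1[of x] by (intro mult_left_mono) auto
    also have "\<dots> = (\<Sum>b\<in>Basis. r * \<bar>b \<bullet> x\<bar>)"
      by (simp add: sum_distrib_left inner_commute)
    also have "\<dots> \<le> (\<Sum>b\<in>(Basis::'a set). \<psi> x + M)"
      using comp by (intro sum_mono)
    finally show ?thesis
      by simp
  qed
  \<comment> \<open>A nonempty compact sublevel set, on which the minimum over the whole space is attained.\<close>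
  define S where "S = {x. \<psi> x \<le> \<psi> 0}"
  have cont: "continuous_on A \<psi>" for A
    unfolding \<psi>_def by (intro continuous_intros continuous)
  have "bounded S"
  proof (rule boundedI)
    fix x assume "x \<in> S"
    then have "r * norm x \<le> DIM('a) * (\<psi> 0 + M)"
      using coercive[of x] by (smt (verit) S_def mem_Collect_eq mult_left_mono of_nat_0_le_iff)
    then show "norm x \<le> DIM('a) * (\<psi> 0 + M) / r"
      using r by (simp add: field_simps)
  qed
  moreover have "closed S"
    unfolding S_def by (intro closed_Collect_le cont continuous_on_const)
  ultimately have "compact S"
    using compact_eq_bounded_closed by blast
  moreover have "0 \<in> S"
    by (simp add: S_def)
  ultimately obtain x0 where x0: "x0 \<in> S" "\<And>x. x \<in> S \<Longrightarrow> \<psi> x0 \<le> \<psi> x"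
    using continuous_attains_inf[OF _ _ cont] by (metis empty_iff)
  then have min: "\<psi> x0 \<le> \<psi> x" for x
    by (smt (verit) S_def mem_Collect_eq)
  have "GDERIV \<psi> x0 :> gradient \<phi> x0 - y"
    unfolding \<psi>_def
    by (intro GDERIV_diff GDERIV_gradient differentiable)
      (simp add: gderiv_def inner_commute bounded_linear_imp_has_derivative bounded_linear_inner_left)
  then have "(\<lambda>h. h \<bullet> (gradient \<phi> x0 - y)) = (\<lambda>h. 0)"
    using min unfolding gderiv_def by (intro has_derivative_local_min) auto
  then have "gradient \<phi> x0 - y = 0"
    by (metis inner_eq_zero_iff)
  then show "y \<in> range (gradient \<phi>)"
    by (metis eq_iff_diff_eq_0 rangeI)
qed

section \<open>Increments of a Legendre function in dual coordinates\<close>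

text \<open>The next two lemmas together say that \<open>\<phi>(u + d) - \<phi>(u)\<close> is the maximum over \<open>z\<close> of
  \<open>\<langle>z, d\<rangle> - D(z, \<nabla>\<phi>(u))\<close>: this one gives the maximiser \<open>z = \<nabla>\<phi>(u + d)\<close>, where the
  Fenchel-Young inequality is an equality, and the following one gives the upper bound.\<close>

lemma increment_eq_bregman:
  "bregman conjugate (gradient \<phi> (u + d)) (gradient \<phi> u)
     = ereal (gradient \<phi> (u + d) \<bullet> d - (\<phi> (u + d) - \<phi> u))"
proof -
  have "gradient \<phi> (u + d) \<in> effective_domain conjugate"
    using gradient_in_interior_domain interior_subset by blast
  then show ?thesis
    by (simp add: bregman_def gradient_in_interior_domain conj_gradient egradient_conj_gradient
        inner_add_right inner_diff_right inner_commute[of u])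
qed

lemma increment_ge_bregman:
  assumes "bregman conjugate z (gradient \<phi> u) \<le> ereal r"
  shows "z \<bullet> d - r \<le> \<phi> (u + d) - \<phi> u"
proof -
  have "z \<in> effective_domain conjugate"
    using assms by (auto simp: bregman_def split: if_splits)
  then have "conjugate z - conjugate (gradient \<phi> u) - ereal (egradient conjugate (gradient \<phi> u) \<bullet> (z - gradient \<phi> u)) \<le> ereal r"
    using assms by (simp add: bregman_def gradient_in_interior_domain)
  then have "conjugate z - ereal (gradient \<phi> u \<bullet> u - \<phi> u) - ereal (u \<bullet> (z - gradient \<phi> u)) \<le> ereal r"
    by (simp add: conj_gradient egradient_conj_gradient)
  then have "z \<bullet> (u + d) - \<phi> (u + d) - (gradient \<phi> u \<bullet> u - \<phi> u) - u \<bullet> (z - gradient \<phi> u) \<le> r"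
    using Fenchel_Young[of z "u + d" \<phi>] by (cases "conjugate z") auto
  then show ?thesis
    by (simp add: inner_add_right inner_diff_right inner_commute)
qed

text \<open>Concavity of the increment in the dual variable. Joint convexity is applied to the pairs of
  maximisers \<open>\<nabla>\<phi>(u\<^sub>i + d)\<close> and base points \<open>\<nabla>\<phi>(u\<^sub>i)\<close>. It is used twice: as an inequality, and for
  the existence of \<open>v\<close>, since finiteness of the Bregman distance at the averaged pair places the
  average of the \<open>\<nabla>\<phi>(u\<^sub>i)\<close> in the interior of the domain, hence in the range of \<open>\<nabla>\<phi>\<close>.\<close>

lemma convex_combination_of_increments_le:
  fixes u :: "'i \<Rightarrow> 'a"
  assumes "econvex (\<lambda>(x, y). bregman conjugate x y)"
    and "finite I" and "sum \<alpha> I = 1" and "\<And>i. i \<in> I \<Longrightarrow> \<alpha> i \<ge> 0"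
  obtains v where "gradient \<phi> v = (\<Sum>i\<in>I. \<alpha> i *\<^sub>R gradient \<phi> (u i))"
    and "\<And>d. (\<Sum>i\<in>I. \<alpha> i * (\<phi> (u i + d) - \<phi> (u i))) \<le> \<phi> (v + d) - \<phi> v"
proof -
  let ?y = "\<Sum>i\<in>I. \<alpha> i *\<^sub>R gradient \<phi> (u i)"
  define z where "z d i = gradient \<phi> (u i + d)" for d i
  define r where "r d i = z d i \<bullet> d - (\<phi> (u i + d) - \<phi> (u i))" for d i
  have joint: "bregman conjugate (\<Sum>i\<in>I. \<alpha> i *\<^sub>R z d i) ?y \<le> ereal (\<Sum>i\<in>I. \<alpha> i * r d i)" for d
  proof -
    let ?E = "{(p, r::real). (\<lambda>(x, y). bregman conjugate x y) p \<le> ereal r}"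
    have "(\<Sum>i\<in>I. \<alpha> i *\<^sub>R ((z d i, gradient \<phi> (u i)), r d i)) \<in> ?E"
      using assms increment_eq_bregman
      by (intro convex_sum) (auto simp: econvex_def z_def r_def)
    moreover have "(\<Sum>i\<in>I. \<alpha> i *\<^sub>R ((z d i, gradient \<phi> (u i)), r d i))
        = ((\<Sum>i\<in>I. \<alpha> i *\<^sub>R z d i, ?y), \<Sum>i\<in>I. \<alpha> i * r d i)"
      by (simp add: prod_eq_iff fst_sum snd_sum)
    ultimately show ?thesis
      by simp
  qed
  \<comment> \<open>The Bregman distance is infinite unless its second argument is interior; any \<open>d\<close> would do.\<close>
  have "?y \<in> interior (effective_domain conjugate)"
    using joint[of 0] by (auto simp: bregman_def split: if_splits)
  then obtain v where v: "gradient \<phi> v = ?y"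
    using interior_domain_subset_range_gradient by (metis imageE subsetD)
  have "(\<Sum>i\<in>I. \<alpha> i * (\<phi> (u i + d) - \<phi> (u i))) \<le> \<phi> (v + d) - \<phi> v" for d
  proof -
    have "(\<Sum>i\<in>I. \<alpha> i * (\<phi> (u i + d) - \<phi> (u i))) = (\<Sum>i\<in>I. \<alpha> i *\<^sub>R z d i) \<bullet> d - (\<Sum>i\<in>I. \<alpha> i * r d i)"
      by (simp add: r_def inner_sum_left right_diff_distrib sum_subtractf)
    also have "\<dots> \<le> \<phi> (v + d) - \<phi> v"
      using joint[of d] by (intro increment_ge_bregman) (simp add: v)
    finally show ?thesis .
  qed
  then show thesis
    using that v by blast
qed

section \<open>Anisotropic smoothness\<close>

lemma scaled_increment_mono:
  assumes "0 < l" and "l \<le> L"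
  shows "(\<phi> (u + l *\<^sub>R d) - \<phi> u) / l \<le> (\<phi> (u + L *\<^sub>R d) - \<phi> u) / L"
proof -
  define t where "t = l / L"
  have t: "0 \<le> t" "t \<le> 1"
    using assms by (auto simp: t_def)
  have "t * L = l"
    using assms by (simp add: t_def)
  then have "(1 - t) *\<^sub>R u + t *\<^sub>R (u + L *\<^sub>R d) = u + l *\<^sub>R d"
    by (simp add: scaleR_add_right scaleR_diff_left)
  then have "\<phi> (u + l *\<^sub>R d) - \<phi> u \<le> t * (\<phi> (u + L *\<^sub>R d) - \<phi> u)"
    using convex_onD[OF convex, of t u "u + L *\<^sub>R d"] t by (simp add: algebra_simps del: scaleR_scaleR)
  then show ?thesis
    using assms by (simp add: t_def field_simps)
qed

lemma epi_scaling_increment: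
  assumes "L > 0"
  shows "epi_scaling (1 / L) \<phi> (d + inverse L *\<^sub>R u) - epi_scaling (1 / L) \<phi> (inverse L *\<^sub>R u)
    = (\<phi> (u + L *\<^sub>R d) - \<phi> u) / L"
  using assms by (simp add: epi_scaling_def scaleR_add_right add.commute diff_divide_distrib)

text \<open>The primal form of the definition: the conjugate disappears, and the range condition becomes the
  existence of \<open>u\<close>.\<close>

lemma anisotropically_smooth_iff:
  "anisotropically_smooth \<phi> L f \<longleftrightarrow> C1_fun f \<and> L > 0 \<and>
     (\<forall>xbar. \<exists>u. gradient \<phi> u = gradient f xbar \<and>
        (\<forall>x. f x \<le> f xbar + (\<phi> (u + L *\<^sub>R (x - xbar)) - \<phi> u) / L))"
  (is "_ \<longleftrightarrow> C1_fun f \<and> L > 0 \<and> (\<forall>xbar. \<exists>u. ?descent xbar u)")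
proof (cases "L > 0")
  case True
  have rewrite: "f x \<le> f xbar + epi_scaling (1 / L) \<phi> (x - xbar + inverse L *\<^sub>R egradient conjugate (gradient f xbar))
          - epi_scaling (1 / L) \<phi> (inverse L *\<^sub>R egradient conjugate (gradient f xbar))
      \<longleftrightarrow> f x \<le> f xbar + (\<phi> (u + L *\<^sub>R (x - xbar)) - \<phi> u) / L"
    if "gradient \<phi> u = gradient f xbar" for u x xbar
    using that epi_scaling_increment[OF True, of "x - xbar" u] egradient_conj_gradient[of u]
    by (smt (verit))
  show ?thesis
  proof (intro iffI conjI allI)
    fix xbar assume "anisotropically_smooth \<phi> L f"
    then have "range (gradient f) \<subseteq> range (gradient \<phi>)"
      and ineq: "\<And>x. f x \<le> f xbar + epi_scaling (1 / L) \<phi> (x - xbar + inverse L *\<^sub>R egradient conjugate (gradient f xbar))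
          - epi_scaling (1 / L) \<phi> (inverse L *\<^sub>R egradient conjugate (gradient f xbar))"
      by (auto simp: anisotropically_smooth_def)
    then obtain u where u: "gradient \<phi> u = gradient f xbar"
      by (metis imageE rangeI subsetD)
    then show "\<exists>u. ?descent xbar u"
      using ineq rewrite[OF u] by blast
  next
    assume *: "C1_fun f \<and> L > 0 \<and> (\<forall>xbar. \<exists>u. ?descent xbar u)"
    then have "range (gradient f) \<subseteq> range (gradient \<phi>)"
      by (metis image_subset_iff rangeI)
    with * show "anisotropically_smooth \<phi> L f"
      unfolding anisotropically_smooth_def using rewrite by blast
  qed (auto simp: anisotropically_smooth_def)
qed (auto simp: anisotropically_smooth_def)

end

theorem proposition4p9:
  fixes \<phi> :: "real ^ 'n \<Rightarrow> real"
    and f :: "nat \<Rightarrow> real ^ 'n \<Rightarrow> real"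
    and L \<alpha> :: "nat \<Rightarrow> real"
    and m :: nat
  assumes "convex_on UNIV \<phi>"
    and "legendre (\<lambda>x. ereal (\<phi> x))"
    and "\<And>i. i \<in> {1..m} \<Longrightarrow> C1_fun (f i)"
    and "\<And>i. i \<in> {1..m} \<Longrightarrow> L i > 0"
    and "\<And>i. i \<in> {1..m} \<Longrightarrow> anisotropically_smooth \<phi> (L i) (f i)"
    and "econvex (\<lambda>(x, y). bregman (conj_real \<phi>) x y)"
    and "\<And>i. i \<in> {1..m} \<Longrightarrow> \<alpha> i \<ge> 0"
    and "(\<Sum>i=1..m. \<alpha> i) = 1"
  shows "anisotropically_smooth \<phi> (Max (L ` {1..m})) (\<lambda>x. \<Sum>i=1..m. \<alpha> i * f i x)"
proof -
  interpret legendre_function \<phi>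
    by unfold_locales (fact assms)+
  let ?F = "\<lambda>x. \<Sum>i=1..m. \<alpha> i * f i x" and ?L = "Max (L ` {1..m})"
  have "{1..m} \<noteq> {}"
    using assms(8) by force
  then have L_pos: "?L > 0"
    using assms(4) by (subst Max_gr_iff) (auto simp: ex_in_conv)
  have L_ge: "L i \<le> ?L" if "i \<in> {1..m}" for i
    using that by simp
  have diff: "f i differentiable (at x)" if "i \<in> {1..m}" for i x
    using that assms(3) by (simp add: C1_fun_def)
  have F_deriv: "GDERIV ?F x :> (\<Sum>i=1..m. \<alpha> i *\<^sub>R gradient (f i) x)" for x
    by (intro GDERIV_weighted_sum diff)
  then have F_grad: "gradient ?F x = (\<Sum>i=1..m. \<alpha> i *\<^sub>R gradient (f i) x)" for x
    by (intro gradient_eqI)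
  have "continuous_on UNIV (\<lambda>x. \<Sum>i=1..m. \<alpha> i *\<^sub>R gradient (f i) x)"
    using assms(3) by (intro continuous_intros) (auto simp: C1_fun_def)
  then have "continuous_on UNIV (gradient ?F)"
    unfolding F_grad .
  then have "C1_fun ?F"
    using F_deriv unfolding C1_fun_def gderiv_def differentiable_def by blast
  moreover have "\<exists>v. gradient \<phi> v = gradient ?F xbar \<and>
      (\<forall>x. ?F x \<le> ?F xbar + (\<phi> (v + ?L *\<^sub>R (x - xbar)) - \<phi> v) / ?L)" for xbar
  proof -
    have "\<exists>w. gradient \<phi> w = gradient (f i) xbar \<and>
        (\<forall>x. f i x \<le> f i xbar + (\<phi> (w + L i *\<^sub>R (x - xbar)) - \<phi> w) / L i)"
      if "i \<in> {1..m}" for i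
      using assms(5)[OF that] unfolding anisotropically_smooth_iff by blast
    then obtain u where u: "\<And>i. i \<in> {1..m} \<Longrightarrow> gradient \<phi> (u i) = gradient (f i) xbar"
      and descent: "\<And>i x. i \<in> {1..m} \<Longrightarrow>
        f i x \<le> f i xbar + (\<phi> (u i + L i *\<^sub>R (x - xbar)) - \<phi> (u i)) / L i"
      by metis
    obtain v where v: "gradient \<phi> v = (\<Sum>i=1..m. \<alpha> i *\<^sub>R gradient \<phi> (u i))"
      and incr: "\<And>d. (\<Sum>i=1..m. \<alpha> i * (\<phi> (u i + d) - \<phi> (u i))) \<le> \<phi> (v + d) - \<phi> v"
      using convex_combination_of_increments_le[OF assms(6) _ assms(8), of u] assms(7) by blast
    have "?F x \<le> ?F xbar + (\<phi> (v + ?L *\<^sub>R (x - xbar)) - \<phi> v) / ?L" for x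
    proof -
      have "?F x \<le> (\<Sum>i=1..m. \<alpha> i * (f i xbar + (\<phi> (u i + ?L *\<^sub>R (x - xbar)) - \<phi> (u i)) / ?L))"
      proof (intro sum_mono mult_left_mono assms(7))
        fix i assume i: "i \<in> {1..m}"
        show "f i x \<le> f i xbar + (\<phi> (u i + ?L *\<^sub>R (x - xbar)) - \<phi> (u i)) / ?L"
          using descent[OF i, of x] scaled_increment_mono[OF assms(4)[OF i] L_ge[OF i], of "u i" "x - xbar"]
          by linarith
      qed
      also have "\<dots> = ?F xbar + (\<Sum>i=1..m. \<alpha> i * (\<phi> (u i + ?L *\<^sub>R (x - xbar)) - \<phi> (u i))) / ?L"
        by (simp add: distrib_left sum.distrib sum_divide_distrib)
      also have "\<dots> \<le> ?F xbar + (\<phi> (v + ?L *\<^sub>R (x - xbar)) - \<phi> v) / ?L"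
        using incr L_pos by (intro add_left_mono divide_right_mono) auto
      finally show ?thesis .
    qed
    moreover have "gradient \<phi> v = gradient ?F xbar"
      unfolding v F_grad by (intro sum.cong) (simp_all add: u)
    ultimately show ?thesis
      by blast
  qed
  ultimately show ?thesis
    unfolding anisotropically_smooth_iff using L_pos by blast
qed

end
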